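(* For any integer $n\geq 2$, we have $$\det\left[q^{|j-k+1|}-t\right]_{1\leq j,k\leq n}=t\,(q-1)^n(q+1)^{n-2}.$$
   Context: Here $q$ and $t$ are variables (indeterminates). In $[a_{jk}]_{1\leq j,k\leq n}$, $j$ is the row index and $k$ the column index. *)

theory Defs
  imports Jordan_Normal_Form.Determinant "HOL-Computational_Algebra.Polynomial"
begin

text \<open>The polynomial ring \<open>R[q,t]\<close> over a commutative ring \<open>R\<close> is represented as
  \<open>R[q][t]\<close>: the outer polynomial variable is \<open>t\<close>, and \<open>q\<close> is the variable of the
  coefficient ring, embedded as a constant polynomial.\<close>

definition q_var :: "'a::comm_ring_1 poly poly" where
  "q_var = [:[:0, 1:]:]"

definition t_var :: "'a::comm_ring_1 poly poly" where
  "t_var = [:0, 1:]"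

text \<open>Matrices of type \<^typ>\<open>'a mat\<close> are indexed from 0; here \<open>a j k\<close> is the entry in row \<open>j\<close>
  and column \<open>k\<close> with indices running from 1 to \<open>n\<close>.\<close>

definition mat1 :: "nat \<Rightarrow> (nat \<Rightarrow> nat \<Rightarrow> 'a) \<Rightarrow> 'a mat" where
  "mat1 n a = mat n n (\<lambda>(j, k). a (Suc j) (Suc k))"

end

theory Submission
  imports Defs
begin

text \<open>Subtracting \<open>q\<close> times column 2 from column 1 makes column 1 the constant vector \<open>t(q - 1)\<close>.
  Once this factor is pulled out, the all-ones vector left behind clears \<open>t\<close> from the other columns. What remains is the matrix whose columns are
  \<open>q\<^bsup>|j-k|\<^esup>\<close> for \<open>k < n\<close> and the all-ones vector; subtracting from each of its rows \<open>q\<close> times the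
  preceding row makes it upper triangular.\<close>

lemma det_abs_power_ones:
  fixes q :: "'b::comm_ring_1"
  shows "det (mat (Suc (Suc m)) (Suc (Suc m))
           (\<lambda>(j, k). if k = Suc m then 1 else q ^ nat \<bar>int j - int k\<bar>))
       = (1 - q) * (1 - q ^ 2) ^ m" (is "det ?B = _")
proof -
  let ?N = "Suc (Suc m)"
  \<comment> \<open>Left multiplication by \<open>L\<close> does all the row operations at once,
    each row using the original preceding row; \<open>C\<close> is the result.\<close>
  define L where "L = mat ?N ?N (\<lambda>(j, k). if j = k then 1 else if j = Suc k then - q else 0)"
  define C where "C = mat ?N ?N (\<lambda>(j, k).
    if j = 0 then (if k = Suc m then 1 else q ^ k)
    else if k = Suc m then 1 - q
    else if k < j then 0 else (1 - q ^ 2) * q ^ (k - j))"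
  have dims: "L \<in> carrier_mat ?N ?N" "?B \<in> carrier_mat ?N ?N" "C \<in> carrier_mat ?N ?N"
    by (simp_all add: L_def C_def)
  have entry: "(\<Sum>i = 0..<?N. L $$ (j, i) * f i) = f j - (if j = 0 then 0 else q * f (j - 1))"
    if "j < ?N" for j and f :: "nat \<Rightarrow> 'b"
  proof -
    have "(\<Sum>i = 0..<?N. L $$ (j, i) * f i)
        = (\<Sum>i = 0..<?N. (if i = j then f j else 0)
            + (if i = j - 1 then (if j = 0 then 0 else - q * f (j - 1)) else 0))"
      using that by (intro sum.cong) (auto simp: L_def)
    then show ?thesis
      using that by (auto simp: sum.distrib simp del: sum.op_ivl_Suc)
  qed
  have "L * ?B = C"
  proof (rule eq_matI)
    fix j k assume "j < dim_row C" "k < dim_col C"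
    then have jk: "j < ?N" "k < ?N" by (simp_all add: C_def)
    have "(L * ?B) $$ (j, k) = (\<Sum>i = 0..<?N. L $$ (j, i) * ?B $$ (i, k))"
      using jk dims by (simp add: scalar_prod_def L_def del: sum.op_ivl_Suc)
    also have "\<dots> = ?B $$ (j, k) - (if j = 0 then 0 else q * ?B $$ (j - 1, k))"
      using entry[OF jk(1)] .
    also have "\<dots> = C $$ (j, k)"
    proof (cases j)
      case 0
      then show ?thesis using jk by (simp add: C_def)
    next
      case (Suc i)
      \<comment> \<open>The ones column gives \<open>1 - q\<close>. Below the diagonal the exponent
        drops by one from row \<open>j\<close> to row \<open>j - 1\<close>, so the entries cancel;
        from the diagonal on it rises by one, which leaves the factor
        \<open>1 - q ^ 2\<close>.\<close>
      consider "k = Suc m" | "k \<noteq> Suc m" "k < j" | "k \<noteq> Suc m" "j \<le> k" by linarith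
      then show ?thesis
      proof cases
        case 2
        then have "nat \<bar>int j - int k\<bar> = Suc (nat \<bar>int i - int k\<bar>)"
          using Suc by (simp add: nat_eq_iff)
        then show ?thesis using 2 Suc jk by (simp add: C_def)
      next
        case 3
        then have "nat \<bar>int j - int k\<bar> = k - j" "nat \<bar>int i - int k\<bar> = Suc (k - j)"
          using Suc by auto
        then show ?thesis using 3 Suc jk
          by (simp add: C_def power2_eq_square algebra_simps)
      qed (use Suc jk in \<open>simp add: C_def\<close>)
    qed
    finally show "(L * ?B) $$ (j, k) = C $$ (j, k)" .
  qed (simp_all add: L_def C_def)
  moreover have "det L = 1"
  proof -
    have "det L = prod_list (diag_mat L)"
      by (rule det_lower_triangular[OF _ dims(1)]) (simp add: L_def)
    also have "\<dots> = 1"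
      unfolding prod_list_diag_prod by (rule prod.neutral) (simp add: L_def)
    finally show ?thesis .
  qed
  moreover have "det C = (1 - q) * (1 - q ^ 2) ^ m"
  proof -
    have "det C = prod_list (diag_mat C)"
      by (rule det_upper_triangular[OF _ dims(3)]) (auto simp: C_def upper_triangular_def)
    also have "\<dots> = (\<Prod>i = 0..<?N. C $$ (i, i))"
      using dims(3) by (simp add: prod_list_diag_prod del: prod.op_ivl_Suc)
    \<comment> \<open>The first and last diagonal entries, \<open>1\<close> and
      \<open>1 - q\<close>, are exceptional; the \<open>m\<close> between them all equal
      \<open>1 - q ^ 2\<close>.\<close>
    also have "\<dots> = C $$ (0, 0) * ((\<Prod>i = 0..<m. C $$ (Suc i, Suc i)) * C $$ (Suc m, Suc m))"
      by (subst prod.atLeast0_lessThan_Suc_shift) (simp only: prod.atLeast0_lessThan_Suc o_def)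
    also have "(\<Prod>i = 0..<m. C $$ (Suc i, Suc i)) = (\<Prod>i = 0..<m. 1 - q ^ 2)"
      by (rule prod.cong) (auto simp: C_def)
    finally show ?thesis by (simp add: C_def mult.commute)
  qed
  ultimately show ?thesis
    using det_mult[OF dims(1,2)] by simp
qed

text \<open>After the column operation the matrix factors as \<open>B * V\<close>, where
  \<open>V\<close> carries everything that involves \<open>t\<close>. Writing the size as
  \<open>Suc (Suc m)\<close> provides the two columns and avoids the exponent
  \<open>n - 2\<close>.\<close>

lemma det_abs_power_shift_minus:
  fixes q t :: "'b::comm_ring_1"
  shows "det (mat (Suc (Suc m)) (Suc (Suc m)) (\<lambda>(j, k). q ^ nat \<bar>int j - int k + 1\<bar> - t))
       = t * (q - 1) ^ Suc (Suc m) * (q + 1) ^ m" (is "det ?A = _")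
proof -
  let ?N = "Suc (Suc m)"
  define B where "B = mat ?N ?N (\<lambda>(j, k). if k = Suc m then 1 else q ^ nat \<bar>int j - int k\<bar>)"
  \<comment> \<open>Column 0 of \<open>V\<close> is \<open>t * (q - 1)\<close> times the last unit
    vector, which selects the ones column of \<open>B\<close>. Column \<open>k > 0\<close> selects
    column \<open>k - 1\<close> of \<open>B\<close> and subtracts \<open>t\<close> times the ones
    column.\<close>
  define V where "V = mat ?N ?N (\<lambda>(j, k).
    if j = Suc m then (if k = 0 then t * (q - 1) else - t) else if k = Suc j then 1 else 0)"
  have dims: "?A \<in> carrier_mat ?N ?N" "B \<in> carrier_mat ?N ?N" "V \<in> carrier_mat ?N ?N"
    by (simp_all add: B_def V_def)
  have "addcol (- q) 0 1 ?A = B * V"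
  proof (rule eq_matI)
    fix j k assume "j < dim_row (B * V)" "k < dim_col (B * V)"
    then have jk: "j < ?N" "k < ?N" by (simp_all add: B_def V_def)
    have "(B * V) $$ (j, k) = (\<Sum>i = 0..<?N. B $$ (j, i) * V $$ (i, k))"
      using jk dims by (simp add: scalar_prod_def B_def V_def del: sum.op_ivl_Suc)
    also have "\<dots> = (\<Sum>i = 0..<Suc m. B $$ (j, i) * V $$ (i, k))
        + (if k = 0 then t * (q - 1) else - t)"
      using jk by (simp add: B_def V_def)
    also have "(\<Sum>i = 0..<Suc m. B $$ (j, i) * V $$ (i, k))
        = (\<Sum>i = 0..<Suc m. if i = k - 1 then (if k = 0 then 0 else B $$ (j, k - 1)) else 0)"
      using jk by (intro sum.cong) (auto simp: V_def)
    also have "\<dots> = (if k = 0 then 0 else q ^ nat \<bar>int j - int (k - 1)\<bar>)"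
      using jk by (auto simp: B_def simp del: sum.op_ivl_Suc)
    finally have *: "(B * V) $$ (j, k) = (if k = 0 then 0 else q ^ nat \<bar>int j - int (k - 1)\<bar>)
        + (if k = 0 then t * (q - 1) else - t)" .
    show "addcol (- q) 0 1 ?A $$ (j, k) = (B * V) $$ (j, k)"
    proof (cases k)
      case 0
      have "nat \<bar>int j + 1\<bar> = Suc j" by simp
      with 0 show ?thesis unfolding * using jk by (simp add: algebra_simps)
    next
      case (Suc i)
      then show ?thesis unfolding * using jk by (simp add: algebra_simps)
    qed
  qed (simp_all add: B_def V_def)
  moreover have "det (addcol (- q) 0 1 ?A) = det ?A"
    by (rule det_addcol[OF _ _ dims(1)]) simp_all
  moreover have "det V = t * (q - 1) * (- 1) ^ Suc m"
  proof -
    \<comment> \<open>Column 0 of \<open>V\<close> is zero except at the bottom, so Laplace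
      expansion leaves one term, with an identity minor and sign
      \<open>(- 1) ^ Suc m\<close>.\<close>
    have "mat_delete V (Suc m) 0 = 1\<^sub>m (Suc m)"
      by (rule eq_matI) (auto simp: mat_delete_def V_def)
    moreover have "det V = (\<Sum>i<?N. V $$ (i, 0) * cofactor V i 0)"
      by (rule laplace_expansion_column[OF dims(3)]) simp
    moreover have "(\<Sum>i<Suc m. V $$ (i, 0) * cofactor V i 0) = 0"
      by (rule sum.neutral) (simp add: V_def)
    ultimately show ?thesis
      by (simp add: cofactor_def) (simp add: V_def)
  qed
  ultimately have "det ?A = (1 - q) * (1 - q ^ 2) ^ m * (t * (q - 1) * (- 1) ^ Suc m)"
    using det_mult[OF dims(2,3)] det_abs_power_ones[of m q] by (simp add: B_def)
  \<comment> \<open>One sign turns \<open>1 - q\<close> into \<open>q - 1\<close>; the other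
    \<open>m\<close> are absorbed into the factors \<open>1 - q ^ 2\<close>.\<close>
  also have "\<dots> = t * (q - 1) ^ 2 * ((1 - q ^ 2) * (- 1)) ^ m"
    unfolding power_mult_distrib by (simp add: power2_eq_square algebra_simps)
  also have "(1 - q ^ 2) * (- 1) = (q - 1) * (q + 1)"
    by (simp add: power2_eq_square algebra_simps)
  finally show ?thesis
    by (simp only: power_mult_distrib power2_eq_square power_Suc mult.assoc)
qed

theorem corollary1p2:
  fixes n :: nat
  assumes "n \<ge> 2"
  shows "det (mat1 n (\<lambda>j k. q_var ^ nat \<bar>int j - int k + 1\<bar> - t_var))
       = (t_var :: 'a::comm_ring_1 poly poly) * (q_var - 1) ^ n * (q_var + 1) ^ (n - 2)"
proof -
  obtain m where "n = Suc (Suc m)"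
    using assms by (metis Suc_le_D numeral_2_eq_2 Suc_le_mono)
  \<comment> \<open>The passage to 0-based indices shifts \<open>j\<close> and \<open>k\<close>
    alike, so \<open>j - k + 1\<close> is unchanged.\<close>
  moreover have "mat1 n (\<lambda>j k. q_var ^ nat \<bar>int j - int k + 1\<bar> - t_var)
      = mat n n (\<lambda>(j, k). q_var ^ nat \<bar>int j - int k + 1\<bar> - (t_var :: 'a poly poly))"
    by (rule eq_matI) (simp_all add: mat1_def add.commute)
  ultimately show ?thesis
    using det_abs_power_shift_minus[of m "q_var :: 'a poly poly" t_var] by simp
qed

end
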